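(* Let $G$ be a connected $3$-regular graph on $n$ vertices. Choose an orientation $\mathcal{O}$ of $G$ uniformly at random among all $2^{|E(G)|}$ orientations. Let $n_+(\mathcal{O})$ be the number of vertices with out-degree $3$ in $\mathcal{O}$, and let $n_-(\mathcal{O})$ be the number of vertices with in-degree $3$ in $\mathcal{O}$. Then for every integer $k$ the probability that $n_+(\mathcal{O})-n_-(\mathcal{O})=k$ is exactly $$\frac{\binom{n}{n/2-2k}}{2^{n-1}}.$$
   Context: Graphs are finite. The number $n$ of vertices of a $3$-regular graph is even, so $n/2$ is an integer. The binomial coefficient $\binom{n}{m}$ is $0$ if $m<0$ or $m>n$. *)

theory Defs
  imports "HOL-Probability.Probability_Mass_Function"
    "Graph_Theory.Digraph_Component" "Graph_Theory.Bidirected_Digraph"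
begin

text \<open>
  An undirected graph is given as a \<^locale>\<open>bidirected_digraph\<close> \<open>G\<close> with arc reversal \<open>arev\<close>: each
  edge is a pair \<open>{a, arev a}\<close> of mutually reverse arcs.  Parallel edges and loops are allowed; a
  simple graph is the case of a symmetric loop-free set of pairs of vertices with \<open>arev (u, v) = (v, u)\<close>
  on arcs.  The degree of a vertex is its \<^const>\<open>out_degree\<close> in \<open>G\<close> (so a loop, having two arcs, counts
  twice).
\<close>

definition edges :: "('a, 'b) pre_digraph \<Rightarrow> ('b \<Rightarrow> 'b) \<Rightarrow> 'b set set" where
  "edges G arev = (\<lambda>a. {a, arev a}) ` arcs G"

definition regular :: "nat \<Rightarrow> ('a, 'b) pre_digraph \<Rightarrow> bool" where
  "regular d G \<longleftrightarrow> (\<forall>v\<in>verts G. out_degree G v = d)"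

definition orientations :: "('a, 'b) pre_digraph \<Rightarrow> ('b \<Rightarrow> 'b) \<Rightarrow> ('a, 'b) pre_digraph set" where
  "orientations G arev =
     {G\<lparr>arcs := A\<rparr> | A. A \<subseteq> arcs G \<and> (\<forall>e\<in>edges G arev. \<exists>!a. a \<in> e \<and> a \<in> A)}"

definition n_plus :: "('a, 'b) pre_digraph \<Rightarrow> nat" where
  "n_plus H = card {v \<in> verts H. out_degree H v = 3}"

definition n_minus :: "('a, 'b) pre_digraph \<Rightarrow> nat" where
  "n_minus H = card {v \<in> verts H. in_degree H v = 3}"

definition int_binomial :: "nat \<Rightarrow> int \<Rightarrow> nat" where
  "int_binomial n m = (if m < 0 then 0 else n choose nat m)"

text \<open>
  The following two facts show that \<^const>\<open>pmf_of_set\<close> of the orientations is the uniform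
  distribution on exactly \<open>2 ^ |E(G)|\<close> orientations (it is unspecified on infinite or empty sets).
\<close>

lemma card_orientations:
  assumes "bidirected_digraph G arev" "fin_digraph G"
  shows "card (orientations G arev) = 2 ^ card (edges G arev)"
proof -
  interpret bidirected_digraph G arev by fact
  interpret F: fin_digraph G by fact
  let ?E = "edges G arev"
  let ?S = "{A. A \<subseteq> arcs G \<and> (\<forall>e\<in>?E. \<exists>!a. a \<in> e \<and> a \<in> A)}"
  have finE: "finite ?E" by (simp add: edges_def)
  have edge_eq: "e = {a, arev a}" if "e \<in> ?E" "a \<in> e" for e a
    using that by (auto simp: edges_def)
  have edge_arcs: "a \<in> arcs G" if "e \<in> ?E" "a \<in> e" for e a
    using that by (auto simp: edges_def)
  have card_e: "card e = 2" if e: "e \<in> ?E" for e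
  proof -
    obtain a where "a \<in> arcs G" "e = {a, arev a}" using e by (auto simp: edges_def)
    then show ?thesis using arev_neq[of a] by simp
  qed
  have "orientations G arev = (\<lambda>A. G\<lparr>arcs := A\<rparr>) ` ?S"
    by (auto simp: orientations_def)
  moreover have "inj_on (\<lambda>A. G\<lparr>arcs := A\<rparr>) ?S"
  proof (rule inj_onI)
    fix A B assume "G\<lparr>arcs := A\<rparr> = G\<lparr>arcs := B\<rparr>"
    then have "arcs (G\<lparr>arcs := A\<rparr>) = arcs (G\<lparr>arcs := B\<rparr>)" by simp
    then show "A = B" by simp
  qed
  ultimately have 1: "card (orientations G arev) = card ?S" by (simp add: card_image)
  have "bij_betw (\<lambda>f. f ` ?E) (PiE ?E (\<lambda>e. e)) ?S"
  proof (rule bij_betw_byWitness[where f' = "\<lambda>A. \<lambda>e\<in>?E. THE a. a \<in> e \<and> a \<in> A"])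
    have uniq: "a = f e"
      if f: "f \<in> PiE ?E (\<lambda>e. e)" and e: "e \<in> ?E" "a \<in> e" "a \<in> f ` ?E" for f e a
    proof -
      from e obtain e' where e': "e' \<in> ?E" "a = f e'" by blast
      have ae: "a \<in> e'" using PiE_mem[OF f e'(1)] e'(2) by simp
      have "e' = e" by (rule trans[OF edge_eq[OF e'(1) ae] edge_eq[OF e(1,2), symmetric]])
      then show ?thesis using e' by simp
    qed
    show "\<forall>f\<in>PiE ?E (\<lambda>e. e). (\<lambda>e\<in>?E. THE a. a \<in> e \<and> a \<in> f ` ?E) = f"
    proof
      fix f assume f: "f \<in> PiE ?E (\<lambda>e. e)"
      show "(\<lambda>e\<in>?E. THE a. a \<in> e \<and> a \<in> f ` ?E) = f"
      proof
        fix e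
        show "(\<lambda>e\<in>?E. THE a. a \<in> e \<and> a \<in> f ` ?E) e = f e"
        proof (cases "e \<in> ?E")
          case True
          have "(THE a. a \<in> e \<and> a \<in> f ` ?E) = f e"
          proof (rule the_equality)
            show "f e \<in> e \<and> f e \<in> f ` ?E" using PiE_mem[OF f True] True by blast
          qed (use uniq[OF f True] in blast)
          then show ?thesis using True by simp
        next
          case False
          then show ?thesis using PiE_arb[OF f False] by simp
        qed
      qed
    qed
    show "(\<lambda>f. f ` ?E) ` PiE ?E (\<lambda>e. e) \<subseteq> ?S"
    proof (intro image_subsetI CollectI conjI ballI)
      fix f assume f: "f \<in> PiE ?E (\<lambda>e. e)"
      show "f e \<in> arcs G" if "e \<in> ?E" for e using edge_arcs[OF that PiE_mem[OF f that]] .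
      fix e assume e: "e \<in> ?E"
      show "\<exists>!a. a \<in> e \<and> a \<in> f ` ?E"
      proof (rule ex1I)
        show "f e \<in> e \<and> f e \<in> f ` ?E" using PiE_mem[OF f e] e by blast
      qed (auto intro: uniq[OF f e])
    qed
    have the: "(THE a. a \<in> e \<and> a \<in> A) \<in> e \<inter> A" if "A \<in> ?S" "e \<in> ?E" for A e
    proof -
      have "\<exists>!a. a \<in> e \<and> a \<in> A" using that by blast
      from theI'[OF this] show ?thesis by blast
    qed
    show "(\<lambda>A. \<lambda>e\<in>?E. THE a. a \<in> e \<and> a \<in> A) ` ?S \<subseteq> PiE ?E (\<lambda>e. e)"
    proof (intro image_subsetI PiE_I)
      fix A e assume A: "A \<in> ?S" and e: "e \<in> ?E"
      show "(\<lambda>e\<in>?E. THE a. a \<in> e \<and> a \<in> A) e \<in> e" using the[OF A e] e by simp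
    qed simp
    show "\<forall>A\<in>?S. (\<lambda>e\<in>?E. THE a. a \<in> e \<and> a \<in> A) ` ?E = A"
    proof
      fix A assume A: "A \<in> ?S"
      have "(\<lambda>e\<in>?E. THE a. a \<in> e \<and> a \<in> A) ` ?E \<subseteq> A"
      proof (rule image_subsetI)
        fix e assume e: "e \<in> ?E"
        show "(\<lambda>e\<in>?E. THE a. a \<in> e \<and> a \<in> A) e \<in> A" using the[OF A e] e by simp
      qed
      moreover have "a \<in> (\<lambda>e\<in>?E. THE a. a \<in> e \<and> a \<in> A) ` ?E" if a: "a \<in> A" for a
      proof -
        have e: "{a, arev a} \<in> ?E" using a A by (auto simp: edges_def)
        have "\<forall>e\<in>?E. \<exists>!x. x \<in> e \<and> x \<in> A" using A unfolding mem_Collect_eq by (rule conjunct2)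
        from bspec[OF this e] have "\<exists>!x. x \<in> {a, arev a} \<and> x \<in> A" .
        then have "(THE x. x \<in> {a, arev a} \<and> x \<in> A) = a"
          by (rule the1_equality) (use a in auto)
        then show ?thesis using e by (intro image_eqI[of _ _ "{a, arev a}"]) auto
      qed
      ultimately show "(\<lambda>e\<in>?E. THE a. a \<in> e \<and> a \<in> A) ` ?E = A" by blast
    qed
  qed
  then have "card ?S = card (PiE ?E (\<lambda>e. e))" by (rule bij_betw_same_card[symmetric])
  also have "\<dots> = (\<Prod>e\<in>?E. 2)" unfolding card_PiE[OF finE] by (rule prod.cong) (simp_all only: card_e)
  also have "\<dots> = 2 ^ card ?E" by (rule prod_constant)
  finally show ?thesis using 1 by simp
qed

lemma finite_nonempty_orientations:
  assumes "bidirected_digraph G arev" "fin_digraph G"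
  shows "finite (orientations G arev)" "orientations G arev \<noteq> {}"
proof -
  have "card (orientations G arev) > 0" using card_orientations[OF assms] by simp
  then show "finite (orientations G arev)" "orientations G arev \<noteq> {}"
    using card_gt_0_iff by blast+
qed

end

theory Submission
  imports Defs
begin

text \<open>
  Both \<open>n_plus - n_minus\<close> and the sum of the out-degrees are linked vertex by vertex to the parity of
  the out-degree, so in a cubic graph \<open>n_plus - n_minus = k\<close> holds exactly when \<open>n/2 + 2 k\<close> vertices
  have odd out-degree.  Reversing one edge toggles the parity at its two ends; hence in a connected
  graph the set of vertices of odd out-degree is uniformly distributed over the \<open>2 ^ (n - 1)\<close> vertex
  sets whose size has the same parity as the number of edges.
\<close>

section \<open>Parity of finite sets and of binomial indices\<close>

lemma even_card_sym_diff:
  assumes "finite A" "finite B"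
  shows "even (card (sym_diff A B)) \<longleftrightarrow> even (card A) = even (card B)"
proof -
  have "card (sym_diff A B) = card (A - B) + card (B - A)"
    using assms by (intro card_Un_disjoint) auto
  moreover have "card A = card (A - B) + card (A \<inter> B)"
    using assms by (metis card_Diff_subset_Int card_mono finite_Int inf_le1 le_add_diff_inverse2)
  moreover have "card B = card (B - A) + card (A \<inter> B)"
    using assms
    by (metis Int_commute card_Diff_subset_Int card_mono finite_Int inf_le1 le_add_diff_inverse2)
  ultimately show ?thesis by auto
qed

text \<open>Two sets of equal parity differ in an even number of points, and these can be toggled
  two at a time. Writing the pair as \<open>sym_diff {u} {v}\<close> makes it empty for
  \<open>u = v\<close>, which is also the effect of reversing a loop.\<close>

lemma sym_diff_pair_invariant:
  fixes f :: "'a set \<Rightarrow> 'c"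
  assumes fin: "finite V"
    and step: "\<And>X u v. X \<subseteq> V \<Longrightarrow> u \<in> V \<Longrightarrow> v \<in> V \<Longrightarrow> f (sym_diff X (sym_diff {u} {v})) = f X"
    and sub: "X \<subseteq> V" "Y \<subseteq> V"
    and parity: "even (card X) = even (card Y)"
  shows "f X = f Y"
  using sub(1) parity
proof (induction "card (sym_diff X Y)" arbitrary: X rule: less_induct)
  case less
  have finXY: "finite X" "finite Y" "finite (sym_diff X Y)"
    using less.prems sub(2) fin by (auto intro: finite_subset)
  have ev: "even (card (sym_diff X Y))"
    using even_card_sym_diff[OF finXY(1,2)] less.prems by simp
  show ?case
  proof (cases "sym_diff X Y = {}")
    case True
    then have "X = Y" by blast
    then show ?thesis by simp
  next
    case False
    then obtain u where u: "u \<in> sym_diff X Y" by blast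
    \<comment> \<open>A set of even size is not a singleton, so a second point of difference
      exists.\<close>
    have "sym_diff X Y \<noteq> {u}"
      using ev by (metis card.empty card.insert empty_iff finite.emptyI odd_one One_nat_def)
    with u obtain v where v: "v \<in> sym_diff X Y" "u \<noteq> v" by blast
    let ?Z = "sym_diff X (sym_diff {u} {v})"
    have uv: "u \<in> V" "v \<in> V" using u v less.prems sub by auto
    have pair: "sym_diff {u} {v} = {u, v}" using v by auto
    have fZ: "f ?Z = f X" by (rule step[OF less.prems(1) uv])
    have "sym_diff ?Z Y = sym_diff X Y - {u, v}" using u v by auto
    then have "sym_diff ?Z Y \<subset> sym_diff X Y" using u by auto
    then have "card (sym_diff ?Z Y) < card (sym_diff X Y)"
      using finXY(3) by (intro psubset_card_mono)
    moreover have "?Z \<subseteq> V" using less.prems(1) uv by auto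
    moreover have "even (card ?Z) = even (card Y)"
      using even_card_sym_diff[OF finXY(1), of "{u, v}"] v less.prems(2) unfolding pair by simp
    ultimately have "f ?Z = f Y" by (rule less.hyps)
    then show ?thesis using fZ by simp
  qed
qed

text \<open>For \<open>n > 0\<close> the alternating sum of the binomial row vanishes, so even and
  odd indices each receive half of \<open>2 ^ n\<close>; \<open>b\<close> selects the parity
  class.\<close>

lemma sum_choose_parity:
  assumes "n > 0"
  shows "(\<Sum>i | i \<le> n \<and> even i = b. n choose i) = 2 ^ (n - 1)"
proof -
  have eq: "(\<Sum>i | i \<le> n \<and> even i = b. int (n choose i))
    = (\<Sum>i\<le>n. if even i = b then int (n choose i) else 0)"
    by (simp add: sum.inter_filter[symmetric])
  have "2 * (\<Sum>i | i \<le> n \<and> even i = b. int (n choose i)) = 2 ^ n"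
    unfolding eq using choose_even_sum[OF assms, where 'a = int] choose_odd_sum[OF assms, where 'a = int]
    by (cases b) simp_all
  also have "\<dots> = 2 * 2 ^ (n - 1)" using assms by (cases n) auto
  finally have "int (\<Sum>i | i \<le> n \<and> even i = b. n choose i) = int (2 ^ (n - 1))" by simp
  then show ?thesis by (simp only: of_nat_eq_iff)
qed

section \<open>Orientations as sets of arcs\<close>

lemma (in fin_digraph) sum_out_degree: "(\<Sum>v\<in>verts G. out_degree G v) = card (arcs G)"
proof -
  have "(\<Sum>v\<in>verts G. out_degree G v) = (\<Sum>v\<in>verts G. \<Sum>a | a \<in> arcs G \<and> tail G a = v. 1)"
    by (simp add: out_degree_def out_arcs_def)
  also have "\<dots> = card (arcs G)"
    by (subst sum.group) auto
  finally show ?thesis .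
qed

definition odd_verts :: "('a, 'b) pre_digraph \<Rightarrow> 'a set" where
  "odd_verts H = {v \<in> verts H. odd (out_degree H v)}"

locale fin_bidirected_digraph = bidirected_digraph G arev + fin_digraph G
  for G (structure) and arev
begin

text \<open>Since \<open>arev\<close> has no fixed arc, choosing one arc per edge becomes a
  condition on single arcs, which is easy to check after a symmetric difference.\<close>

definition orienting :: "'b set \<Rightarrow> bool" where
  "orienting A \<longleftrightarrow> A \<subseteq> arcs G \<and> (\<forall>a\<in>arcs G. arev a \<in> A \<longleftrightarrow> a \<notin> A)"

lemma orientations_eq: "orientations G arev = (\<lambda>A. G\<lparr>arcs := A\<rparr>) ` {A. orienting A}"
proof -
  have "(\<exists>!x. x \<in> {a, arev a} \<and> x \<in> A) \<longleftrightarrow> (arev a \<in> A \<longleftrightarrow> a \<notin> A)" if "a \<in> arcs G" for a A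
    using arev_neq[OF that] by auto
  then show ?thesis
    by (auto simp: orientations_def edges_def orienting_def)
qed

lemma inj_update_arcs: "inj_on (\<lambda>A. G\<lparr>arcs := A\<rparr>) S"
  by (rule inj_on_inverseI[where g = arcs]) simp

lemma fin_digraph_update_arcs:
  assumes "A \<subseteq> arcs G"
  shows "fin_digraph (G\<lparr>arcs := A\<rparr>)"
  using assms by unfold_locales (auto intro: finite_subset)

text \<open>\<open>A\<close> and its image under \<open>arev\<close> partition the arcs. Hence the
  sum of the out-degrees, and with it the parity of the odd set, does not depend on the
  orientation.\<close>

lemma card_orienting:
  assumes "orienting A"
  shows "2 * card A = card (arcs G)"
proof -
  have "arcs G = A \<union> arev ` A"
    using assms unfolding orienting_def by (auto intro: rev_image_eqI[of "arev _"])
  moreover have "A \<inter> arev ` A = {}"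
    using assms unfolding orienting_def by auto
  moreover have "card (arev ` A) = card A"
    by (rule card_image) auto
  moreover have "finite A"
    using assms unfolding orienting_def by (auto intro: finite_subset)
  ultimately show ?thesis by (simp add: card_Un_disjoint)
qed

text \<open>An arc of \<open>G\<close> leaving \<open>v\<close> either lies in \<open>A\<close> or
  is the reverse of an arc of \<open>A\<close> entering \<open>v\<close>.\<close>

lemma in_degree_plus_out_degree:
  assumes "orienting A"
  shows "in_degree (G\<lparr>arcs := A\<rparr>) v + out_degree (G\<lparr>arcs := A\<rparr>) v = out_degree G v"
proof -
  let ?H = "G\<lparr>arcs := A\<rparr>"
  have sub: "A \<subseteq> arcs G" using assms by (simp add: orienting_def)
  have "out_arcs G v = arev ` in_arcs ?H v \<union> out_arcs ?H v"
    (is "_ = ?R")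
  proof (intro equalityI subsetI)
    fix x assume "x \<in> out_arcs G v"
    then have x: "x \<in> arcs G" "tail G x = v" by (auto simp: out_arcs_def)
    show "x \<in> ?R"
    proof (cases "x \<in> A")
      case False
      then have "arev x \<in> in_arcs ?H v"
        using x assms by (simp add: in_arcs_def orienting_def)
      from imageI[OF this, of arev] show ?thesis by simp
    qed (use x in \<open>simp add: out_arcs_def\<close>)
  qed (use sub in \<open>auto simp: in_arcs_def out_arcs_def\<close>)
  moreover have "arev ` in_arcs ?H v \<inter> out_arcs ?H v = {}"
    using assms unfolding orienting_def by auto
  moreover have "finite (in_arcs ?H v)" "finite (out_arcs ?H v)"
    using finite_subset[OF sub] by (auto simp: in_arcs_def out_arcs_def)
  moreover have "card (arev ` in_arcs ?H v) = card (in_arcs ?H v)"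
    by (rule card_image) auto
  ultimately show ?thesis
    by (simp add: in_degree_def out_degree_def card_Un_disjoint)
qed

section \<open>Edge reversal and equal fibres of the odd set\<close>

definition fibre :: "'a set \<Rightarrow> 'b set set" where
  "fibre X = {A. orienting A \<and> odd_verts (G\<lparr>arcs := A\<rparr>) = X}"

lemma finite_fibre: "finite (fibre X)"
  by (rule finite_subset[of _ "Pow (arcs G)"]) (auto simp: fibre_def orienting_def)

lemma finite_orienting: "finite {A. orienting A}"
  by (rule finite_subset[of _ "Pow (arcs G)"]) (auto simp: orienting_def)

text \<open>Symmetric difference with \<open>{b, arev b}\<close> reverses one edge. This toggles the
  parity at its two ends, and for a loop the two changes cancel.\<close>

lemma reverse_arc_in_fibre:
  assumes b: "b \<in> arcs G" and A: "A \<in> fibre X"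
  shows "sym_diff A {b, arev b} \<in> fibre (sym_diff X (sym_diff {tail G b} {head G b}))"
proof -
  define P where "P = {b, arev b}"
  define B where "B = sym_diff A P"
  have oA: "orienting A" and X: "X = odd_verts (G\<lparr>arcs := A\<rparr>)"
    using A by (auto simp: fibre_def)
  have P: "P \<subseteq> arcs G" using b by (simp add: P_def)
  have arev_P: "arev a \<in> P \<longleftrightarrow> a \<in> P" for a
    unfolding P_def by (metis arev_arev insert_iff empty_iff)
  have mem_B: "a \<in> B \<longleftrightarrow> (a \<in> A) \<noteq> (a \<in> P)" for a
    unfolding B_def by blast
  have oB: "orienting B"
    using oA P by (auto simp: orienting_def mem_B arev_P)
  have fin: "finite A" "finite P"
    using oA by (auto simp: orienting_def P_def intro: finite_subset)
  have parity: "odd (out_degree (G\<lparr>arcs := B\<rparr>) v) \<longleftrightarrow>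
      odd (out_degree (G\<lparr>arcs := A\<rparr>) v) \<noteq> ((v = tail G b) \<noteq> (v = head G b))" for v
  proof -
    let ?P = "{a \<in> P. tail G a = v}"
    have "out_arcs (G\<lparr>arcs := B\<rparr>) v = sym_diff (out_arcs (G\<lparr>arcs := A\<rparr>) v) ?P"
      by (auto simp: out_arcs_def mem_B)
    moreover have "finite (out_arcs (G\<lparr>arcs := A\<rparr>) v)" "finite ?P"
      using fin by (simp_all add: out_arcs_def)
    ultimately have "even (out_degree (G\<lparr>arcs := B\<rparr>) v)
        \<longleftrightarrow> even (out_degree (G\<lparr>arcs := A\<rparr>) v) = even (card ?P)"
      unfolding out_degree_def by (simp only: even_card_sym_diff)
    \<comment> \<open>\<open>arev b\<close> starts at the head of \<open>b\<close>; at the vertex of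
      a loop both arcs count, giving an even number.\<close>
    moreover have "?P = (if tail G b = v then {b} else {}) \<union> (if head G b = v then {arev b} else {})"
      using tail_arev[OF b] unfolding P_def by auto
    then have "odd (card ?P) \<longleftrightarrow> (v = tail G b) \<noteq> (v = head G b)"
      using arev_neq[OF b] by auto
    ultimately show ?thesis by blast
  qed
  have "odd_verts (G\<lparr>arcs := B\<rparr>) = sym_diff X (sym_diff {tail G b} {head G b})"
  proof (rule set_eqI)
    fix v
    have "v \<in> verts G" if "v = tail G b \<or> v = head G b" using that b by auto
    then show "v \<in> odd_verts (G\<lparr>arcs := B\<rparr>) \<longleftrightarrow> v \<in> sym_diff X (sym_diff {tail G b} {head G b})"
      using parity[of v] by (auto simp: X odd_verts_def)
  qed
  then show ?thesis using oB by (simp add: fibre_def B_def P_def)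
qed

text \<open>Reversing the same edge twice restores the orientation, so the reversal is a bijection
  between the two fibres.\<close>

lemma card_fibre_reverse_arc:
  assumes b: "b \<in> arcs G"
  shows "card (fibre (sym_diff X (sym_diff {tail G b} {head G b}))) = card (fibre X)"
proof -
  let ?f = "\<lambda>A. sym_diff A {b, arev b}" and ?Y = "sym_diff X (sym_diff {tail G b} {head G b})"
  have inv: "?f (?f A) = A" for A by auto
  have rev_sym_diff: "sym_diff ?Y (sym_diff {tail G b} {head G b}) = X" by auto
  have "bij_betw ?f (fibre X) (fibre ?Y)"
  proof (rule bij_betw_byWitness[where f' = ?f])
    show "?f ` fibre X \<subseteq> fibre ?Y"
      using reverse_arc_in_fibre[OF b] by blast
    show "?f ` fibre ?Y \<subseteq> fibre X"
      using reverse_arc_in_fibre[OF b, of _ ?Y] unfolding rev_sym_diff by blast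
  qed (intro ballI inv)+
  then show ?thesis by (rule bij_betw_same_card[symmetric])
qed

text \<open>Along a path the toggles at inner vertices cancel, leaving only those at its two
  ends.\<close>

lemma card_fibre_reachable:
  assumes "u \<rightarrow>\<^sup>* v"
  shows "card (fibre (sym_diff X (sym_diff {u} {v}))) = card (fibre X)"
  using assms
proof (induction rule: reachable_induct)
  case base
  then show ?case by simp
next
  case (step v w)
  obtain b where b: "b \<in> arcs G" "tail G b = v" "head G b = w"
    using step.hyps(2) by (auto simp: arcs_ends_conv)
  let ?Y = "sym_diff X (sym_diff {u} {v})"
  have "sym_diff X (sym_diff {u} {w}) = sym_diff ?Y (sym_diff {v} {w})" by auto
  then show ?case
    using card_fibre_reverse_arc[OF b(1), of ?Y] step.IH by (simp only: b)
qed

lemma card_fibre_eq: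
  assumes conn: "Digraph_Component.connected G"
    and "X \<subseteq> verts G" "Y \<subseteq> verts G" "even (card X) = even (card Y)"
  shows "card (fibre X) = card (fibre Y)"
proof (rule sym_diff_pair_invariant[OF finite_verts _ assms(2-4), where f = "\<lambda>X. card (fibre X)"])
  fix X u v
  assume "u \<in> verts G" "v \<in> verts G"
  then have "u \<rightarrow>\<^sup>*\<^bsub>with_proj (mk_symmetric G)\<^esub> v"
    using conn by (auto simp: connected_def)
  \<comment> \<open>Connectedness is stated for the symmetric closure; the arcs of \<open>G\<close>
    are already symmetric.\<close>
  then have "u \<rightarrow>\<^sup>* v" by (simp add: reachable_mk_symmetric_eq[OF sym_arcs])
  then show "card (fibre (sym_diff X (sym_diff {u} {v}))) = card (fibre X)"
    by (rule card_fibre_reachable)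
qed

text \<open>The out-degrees sum to \<open>card A\<close>, and a sum is even exactly when it has
  evenly many odd terms.\<close>

lemma even_card_odd_verts:
  assumes "orienting A"
  shows "even (card (odd_verts (G\<lparr>arcs := A\<rparr>))) \<longleftrightarrow> even (card A)"
proof -
  let ?H = "G\<lparr>arcs := A\<rparr>"
  interpret H: fin_digraph ?H
    using assms by (intro fin_digraph_update_arcs) (simp add: orienting_def)
  have "even (\<Sum>v\<in>verts G. out_degree ?H v) \<longleftrightarrow> even (card {v \<in> verts G. odd (out_degree ?H v)})"
    by (rule even_sum_iff) simp
  then show ?thesis using H.sum_out_degree by (simp add: odd_verts_def)
qed

text \<open>All fibres over sets of the admissible parity have a common size \<open>c\<close>. Thus
  \<open>c\<close> times \<open>n choose m\<close> orientations have \<open>m\<close> odd vertices,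
  out of \<open>c * 2 ^ (n - 1)\<close> in all; the ratio is stated without division.\<close>

lemma card_orienting_odd_verts:
  assumes conn: "Digraph_Component.connected G"
    and par: "even m \<longleftrightarrow> even (card (arcs G) div 2)"
  shows "card {A. orienting A \<and> card (odd_verts (G\<lparr>arcs := A\<rparr>)) = m} * 2 ^ (card (verts G) - 1)
    = (card (verts G) choose m) * card {A. orienting A}"
proof -
  let ?n = "card (verts G)" and ?p = "even (card (arcs G) div 2)"
  let ?S = "\<lambda>i. {A. orienting A \<and> card (odd_verts (G\<lparr>arcs := A\<rparr>)) = i}"
  have npos: "?n > 0"
    using conn by (auto simp: connected_def strongly_connected_def card_gt_0_iff)
  have sub: "odd_verts (G\<lparr>arcs := A\<rparr>) \<subseteq> verts G" for A by (auto simp: odd_verts_def)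
  \<comment> \<open>If no vertex set has the required parity, the condition on \<open>c\<close> is
    vacuous.\<close>
  obtain c where c: "\<And>X. X \<subseteq> verts G \<Longrightarrow> even (card X) = ?p \<Longrightarrow> card (fibre X) = c"
  proof (cases "\<exists>X\<subseteq>verts G. even (card X) = ?p")
    case True
    then obtain X where "X \<subseteq> verts G" "even (card X) = ?p" by blast
    then show ?thesis using card_fibre_eq[OF conn] that[of "card (fibre X)"] by metis
  qed blast
  have count: "card (?S i) = (?n choose i) * c" if "even i = ?p" for i
  proof -
    have "?S i = (\<Union>X\<in>{X. X \<subseteq> verts G \<and> card X = i}. fibre X)"
      using sub by (auto simp: fibre_def)
    also have "card \<dots> = (\<Sum>X | X \<subseteq> verts G \<and> card X = i. card (fibre X))"
      by (rule card_UN_disjoint) (simp_all add: finite_fibre, auto simp: fibre_def)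
    also have "\<dots> = (\<Sum>X | X \<subseteq> verts G \<and> card X = i. c)"
      by (rule sum.cong) (use c that in auto)
    also have "\<dots> = (?n choose i) * c" by (simp add: n_subsets)
    finally show ?thesis .
  qed
  have "{A. orienting A} = (\<Union>i\<in>{i. i \<le> ?n \<and> even i = ?p}. ?S i)"
  proof -
    have "card (odd_verts (G\<lparr>arcs := A\<rparr>)) \<le> ?n" for A
      by (rule card_mono[OF finite_verts sub])
    moreover have "even (card (odd_verts (G\<lparr>arcs := A\<rparr>))) = ?p" if "orienting A" for A
      using even_card_odd_verts[OF that] card_orienting[OF that]
      by (metis nonzero_mult_div_cancel_left zero_neq_numeral)
    ultimately show ?thesis by auto
  qed
  then have "card {A. orienting A} = card (\<Union>i\<in>{i. i \<le> ?n \<and> even i = ?p}. ?S i)"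
    by (rule arg_cong)
  also have "\<dots> = (\<Sum>i | i \<le> ?n \<and> even i = ?p. card (?S i))"
    by (rule card_UN_disjoint) (auto simp: finite_orienting)
  also have "\<dots> = (\<Sum>i | i \<le> ?n \<and> even i = ?p. ?n choose i) * c"
    unfolding sum_distrib_right by (rule sum.cong) (use count in auto)
  also have "\<dots> = 2 ^ (?n - 1) * c" by (simp only: sum_choose_parity[OF npos])
  finally show ?thesis using count[OF par] by simp
qed

section \<open>Cubic graphs: from extreme vertices to odd out-degrees\<close>

text \<open>
  Writing \<open>o\<close> for the out-degree of a vertex, \<open>2 ([o = 3] - [o = 0]) = [o odd] + o - 2\<close> for
  \<open>0 \<le> o \<le> 3\<close>, and the out-degrees sum to \<open>3 n / 2\<close>.
\<close>

lemma card_odd_verts_cubic: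
  assumes reg: "regular 3 G" and A: "orienting A"
  shows "int (card (odd_verts (G\<lparr>arcs := A\<rparr>))) =
    2 * (int (n_plus (G\<lparr>arcs := A\<rparr>)) - int (n_minus (G\<lparr>arcs := A\<rparr>))) + int (card (verts G) div 2)"
    and "even (card (verts G))"
proof -
  let ?H = "G\<lparr>arcs := A\<rparr>"
  interpret H: fin_digraph ?H
    using A by (intro fin_digraph_update_arcs) (simp add: orienting_def)
  have arcs: "card (arcs G) = 3 * card (verts G)"
    using sum_out_degree reg by (simp add: regular_def)
  then show ev: "even (card (verts G))"
    using card_orienting[OF A] by presburger
  have sum_out: "(\<Sum>v\<in>verts G. int (out_degree ?H v)) = int (card A)"
    using H.sum_out_degree by (simp flip: of_nat_sum)
  have count: "int (card {v \<in> verts G. P v}) = (\<Sum>v\<in>verts G. of_bool (P v))" for P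
    by (simp add: Int_def)
  have at_vertex: "2 * (of_bool (out_degree ?H v = 3) - of_bool (in_degree ?H v = 3))
      = of_bool (odd (out_degree ?H v)) + int (out_degree ?H v) - 2" if "v \<in> verts G" for v
  proof -
    \<comment> \<open>In-degree 3 thereby means out-degree 0.\<close>
    have sum3: "in_degree ?H v + out_degree ?H v = 3"
      using in_degree_plus_out_degree[OF A] reg that by (simp add: regular_def)
    then consider "out_degree ?H v = 0" | "out_degree ?H v = 1" | "out_degree ?H v = 2"
      | "out_degree ?H v = 3" by linarith
    then show ?thesis using sum3 by cases auto
  qed
  have "2 * (int (n_plus ?H) - int (n_minus ?H))
      = (\<Sum>v\<in>verts G. 2 * (of_bool (out_degree ?H v = 3) - of_bool (in_degree ?H v = 3)))"
    by (simp add: n_plus_def n_minus_def count sum_subtractf flip: sum_distrib_left)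
  also have "\<dots> = (\<Sum>v\<in>verts G. of_bool (odd (out_degree ?H v)) + int (out_degree ?H v) - 2)"
    by (rule sum.cong) (simp_all only: at_vertex)
  also have "\<dots> = int (card (odd_verts ?H)) + int (card A) - 2 * int (card (verts G))"
    by (simp add: odd_verts_def count sum_out sum.distrib sum_subtractf)
  \<comment> \<open>Here \<open>card A\<close> is \<open>3 n / 2\<close>, so
    \<open>card A - 2 n\<close> equals \<open>- n / 2\<close>.\<close>
  finally show "int (card (odd_verts ?H)) =
      2 * (int (n_plus ?H) - int (n_minus ?H)) + int (card (verts G) div 2)"
    using card_orienting[OF A] arcs ev by (auto elim!: evenE)
qed

end

section \<open>The exact probability\<close>

theorem theorem1p6:
  fixes G :: "('a, 'b) pre_digraph" and arev :: "'b \<Rightarrow> 'b" and n :: nat and k :: int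
  assumes "bidirected_digraph G arev"
    and "fin_digraph G"
    and "Digraph_Component.connected G"
    and "regular 3 G"
    and "card (verts G) = n"
  shows "measure_pmf.prob (pmf_of_set (orientations G arev))
           {H. int (n_plus H) - int (n_minus H) = k}
         = real (int_binomial n (int (n div 2) - 2 * k)) / 2 ^ (n - 1)"
proof -
  interpret bidirected_digraph G arev by fact
  interpret fin_digraph G by fact
  interpret fin_bidirected_digraph G arev by unfold_locales
  let ?O = "orientations G arev" and ?K = "{H. int (n_plus H) - int (n_minus H) = k}"
  \<comment> \<open>The number of odd vertices that corresponds to the value \<open>k\<close>; it is
    kept as an integer because it may be negative. As \<open>n\<close> is even, \<open>?m\<close>
    and the index \<open>n/2 - 2 k\<close> of the claim add up to \<open>n\<close>.\<close>
  let ?m = "int (n div 2) + 2 * k"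
  note O = finite_nonempty_orientations[OF assms(1,2)]
  obtain A where A: "orienting A" using O(2) by (auto simp: orientations_eq)
  have ev: "even n" using card_odd_verts_cubic(2)[OF assms(4) A] assms(5) by simp
  have arcs: "card (arcs G) = 3 * n"
    using sum_out_degree assms(4,5) by (simp add: regular_def)
  have "?O \<inter> ?K = (\<lambda>A. G\<lparr>arcs := A\<rparr>) `
      {A. orienting A \<and> int (card (odd_verts (G\<lparr>arcs := A\<rparr>))) = ?m}"
    using card_odd_verts_cubic(1)[OF assms(4)] assms(5) by (auto simp: orientations_eq)
  then have cardK: "card (?O \<inter> ?K) =
      card {A. orienting A \<and> int (card (odd_verts (G\<lparr>arcs := A\<rparr>))) = ?m}"
    by (simp add: card_image inj_update_arcs)
  have cardO: "card ?O = card {A. orienting A}"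
    by (simp add: orientations_eq card_image inj_update_arcs)
  have main: "card (?O \<inter> ?K) * 2 ^ (n - 1) = int_binomial n (int (n div 2) - 2 * k) * card ?O"
  proof (cases "?m < 0")
    case True
    then have "card (?O \<inter> ?K) = 0" unfolding cardK by (auto simp: card_eq_0_iff)
    \<comment> \<open>A negative \<open>?m\<close> puts the index \<open>n/2 - 2 k\<close> above
      \<open>n\<close>.\<close>
    moreover have "int_binomial n (int (n div 2) - 2 * k) = 0"
      using True ev by (auto simp: int_binomial_def elim!: evenE intro!: binomial_eq_0)
    ultimately show ?thesis by simp
  next
    case False
    then obtain m where m: "?m = int m" by (metis nonneg_int_cases not_less)
    \<comment> \<open>The number of edges is \<open>3 n / 2\<close>, which exceeds \<open>m\<close>
      by the even number \<open>n - 2 k\<close>.\<close>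
    have "even m \<longleftrightarrow> even (card (arcs G) div 2)"
      using m ev unfolding arcs by (auto elim!: evenE) presburger+
    from card_orienting_odd_verts[OF assms(3) this]
    have "card (?O \<inter> ?K) * 2 ^ (n - 1) = (n choose m) * card ?O"
      unfolding cardK cardO by (simp add: m assms(5))
    moreover have "int_binomial n (int (n div 2) - 2 * k) = n choose m"
    proof (cases "m \<le> n")
      case True
      have "int (n div 2) - 2 * k = int (n - m)" using m True ev by (auto elim!: evenE)
      then show ?thesis using binomial_symmetric[OF True] by (simp add: int_binomial_def)
    next
      case False
      \<comment> \<open>For \<open>m > n\<close> the index \<open>n/2 - 2 k\<close> is negative and
        both coefficients are zero.\<close>
      then show ?thesis using m ev by (auto simp: int_binomial_def elim!: evenE)
    qed
    ultimately show ?thesis by simp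
  qed
  have "real (card (?O \<inter> ?K)) * 2 ^ (n - 1) =
      real (int_binomial n (int (n div 2) - 2 * k)) * real (card ?O)"
    using arg_cong[OF main, of real] by simp
  moreover have "card ?O > 0" using O by (simp add: card_gt_0_iff)
  ultimately show ?thesis
    by (simp add: measure_pmf_of_set[OF O(2,1)] field_simps)
qed

end
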